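(* A positive real number $\Delta$ is the determinant of some integral well-rounded (IWR) lattice in $\mathbb R^2$ if and only if $\Delta=M\sqrt D$ with $M,D$ positive integers, $D$ squarefree, such that the set $$\operatorname{mn}(M)=\left\{(m,n)\in\mathbb Z_{>0}^2:\ \gcd(m,n)=1,\ \sqrt{\tfrac D3}\le \tfrac mn\le\sqrt{3D},\ \tfrac{2mn}{2^e\gcd(m,D)}\ \Big|\ M\right\}$$ is nonempty, where $e=e(m,n,D)$ equals $0$ if either $2\mid D$, or ($2\mid D+1$ and $2\mid mn$), and equals $1$ otherwise. Fix such a $\Delta$, and let $(m,n)\in\operatorname{mn}(M)$ be a pair maximizing $\frac mn+D\frac nm$ on $\operatorname{mn}(M)$. Define $$p=\frac{|m^2-Dn^2|}{2^e\gcd(m,D)},\quad r=\frac{2mn}{2^e\gcd(m,D)},\quad q=\frac{m^2+Dn^2}{2^e\gcd(m,D)},\quad k=M/r.$$ Then $\Lambda=\sqrt{k/q}\;\Omega_D(p,q)$ is an IWR lattice with $\det(\Lambda)=\Delta$ and $|\Lambda|=kq$, and $\Lambda$ maximizes $|\Lambda|$ among all IWR lattices in $\mathbb R^2$ with determinant $\Delta$. Moreover, this lattice can be found in a finite number of steps for each fixed $\Delta$.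
   Context: A lattice $\Lambda=A\mathbb Z^N\subset\mathbb R^N$ of full rank (basis matrix $A$) is integral if $A^tA$ has integer entries; $\det(\Lambda)=|\det A|$; $|\Lambda|=\min\{\|x\|^2: x\in\Lambda\setminus\{0\}\}$ (Euclidean norm) is the minimal norm; vectors attaining it are minimal vectors; $\Lambda$ is well-rounded (WR) if its minimal vectors contain $N$ linearly independent vectors. IWR means integral and well-rounded. For integers $p\ge0$, $q,r>0$ with $p^2+Dr^2=q^2$, $\Omega_D(p,q)=\begin{pmatrix} q & p\\ 0 & r\sqrt D\end{pmatrix}\mathbb Z^2$. *)

theory Defs
  imports "HOL-Analysis.Analysis" "HOL-Computational_Algebra.Computational_Algebra"
begin

section \<open>Lattices\<close>

definition lattice_of :: "real^'n^'n \<Rightarrow> (real^'n) set" where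
  "lattice_of A = {A *v z | z. \<forall>i. z $ i \<in> \<int>}"

definition basis_matrix :: "real^'n^'n \<Rightarrow> (real^'n) set \<Rightarrow> bool" where
  "basis_matrix A L \<longleftrightarrow> invertible A \<and> L = lattice_of A"

definition full_lattice :: "(real^'n) set \<Rightarrow> bool" where
  "full_lattice L \<longleftrightarrow> (\<exists>A. basis_matrix A L)"

definition integral_lattice :: "(real^'n) set \<Rightarrow> bool" where
  "integral_lattice L \<longleftrightarrow>
     (\<exists>A. basis_matrix A L \<and> (\<forall>i j. (transpose A ** A) $ i $ j \<in> \<int>))"

text \<open>Any two basis matrices of a lattice differ by a unimodular integer matrix, so the choice
  of the basis matrix does not matter.\<close>

definition lattice_det :: "(real^'n) set \<Rightarrow> real" where
  "lattice_det L = \<bar>det (SOME A. basis_matrix A L)\<bar>"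

definition min_norm :: "(real^'n) set \<Rightarrow> real" where
  "min_norm L = (LEAST a. a \<in> (\<lambda>x. (norm x)\<^sup>2) ` (L - {0}))"

definition minimal_vectors :: "(real^'n) set \<Rightarrow> (real^'n) set" where
  "minimal_vectors L = {x \<in> L - {0}. (norm x)\<^sup>2 = min_norm L}"

definition well_rounded :: "(real^'n) set \<Rightarrow> bool" where
  "well_rounded L \<longleftrightarrow> full_lattice L \<and>
     (\<exists>S \<subseteq> minimal_vectors L. independent S \<and> card S = CARD('n))"

definition IWR :: "(real^'n) set \<Rightarrow> bool" where
  "IWR L \<longleftrightarrow> integral_lattice L \<and> well_rounded L"

text \<open>The lattice \<open>\<Omega>\<^sub>D(p,q)\<close>. The integer \<open>r\<close> does not occur in its name, being determined by
  \<open>p\<close>, \<open>q\<close> and \<open>D\<close>; the definition is meaningful only if such an \<open>r\<close> exists.\<close>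

definition Omega :: "int \<Rightarrow> int \<Rightarrow> int \<Rightarrow> (real^2) set" where
  "Omega D p q =
     (let r = (THE r. 0 < r \<and> p\<^sup>2 + D * r\<^sup>2 = q\<^sup>2)
      in lattice_of (vector [vector [real_of_int q, real_of_int p],
                             vector [0, real_of_int r * sqrt (real_of_int D)]]))"


section \<open>The parametrization\<close>

definition e_exp :: "int \<Rightarrow> int \<Rightarrow> int \<Rightarrow> nat" where
  "e_exp m n D = (if 2 dvd D \<or> (2 dvd D + 1 \<and> 2 dvd m * n) then 0 else 1)"

definition scale :: "int \<Rightarrow> int \<Rightarrow> int \<Rightarrow> int" where
  "scale D m n = 2 ^ e_exp m n D * gcd m D"

definition p_of :: "int \<Rightarrow> int \<Rightarrow> int \<Rightarrow> int" where
  "p_of D m n = \<bar>m\<^sup>2 - D * n\<^sup>2\<bar> div scale D m n"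

definition r_of :: "int \<Rightarrow> int \<Rightarrow> int \<Rightarrow> int" where
  "r_of D m n = (2 * m * n) div scale D m n"

definition q_of :: "int \<Rightarrow> int \<Rightarrow> int \<Rightarrow> int" where
  "q_of D m n = (m\<^sup>2 + D * n\<^sup>2) div scale D m n"

text \<open>The three integer divisions above are exact, and the quotients satisfy the equation that
  \<^const>\<open>Omega\<close> requires.\<close>

lemma scale_dvd:
  shows "scale D m n dvd \<bar>m\<^sup>2 - D * n\<^sup>2\<bar>"
    and "scale D m n dvd 2 * m * n"
    and "scale D m n dvd m\<^sup>2 + D * n\<^sup>2"
proof -
  have d: "gcd m D dvd m\<^sup>2 - D * n\<^sup>2" "gcd m D dvd m\<^sup>2 + D * n\<^sup>2" "gcd m D dvd m"
    by (simp_all add: power2_eq_square)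
  have "scale D m n dvd m\<^sup>2 - D * n\<^sup>2 \<and> scale D m n dvd 2 * m * n \<and> scale D m n dvd m\<^sup>2 + D * n\<^sup>2"
  proof (cases "e_exp m n D = 0")
    case True
    then show ?thesis using d by (simp add: scale_def)
  next
    case False
    then have odd: "odd D" "odd m" "odd n" by (auto simp: e_exp_def split: if_splits)
    then have "coprime 2 (gcd m D)"
      using dvd_trans gcd_dvd2 by (metis coprime_left_2_iff_odd)
    moreover have "2 dvd m\<^sup>2 - D * n\<^sup>2" "2 dvd m\<^sup>2 + D * n\<^sup>2" using odd by simp_all
    moreover have "scale D m n = 2 * gcd m D" using False
      by (auto simp: scale_def e_exp_def split: if_splits)
    ultimately show ?thesis using d by (simp add: divides_mult)
  qed
  then show "scale D m n dvd \<bar>m\<^sup>2 - D * n\<^sup>2\<bar>" "scale D m n dvd 2 * m * n"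
    "scale D m n dvd m\<^sup>2 + D * n\<^sup>2" by simp_all
qed

lemma pqr_equation:
  assumes "0 < D"
  shows "(p_of D m n)\<^sup>2 + D * (r_of D m n)\<^sup>2 = (q_of D m n)\<^sup>2"
proof -
  define g where "g = scale D m n"
  have g: "g \<noteq> 0" using assms by (simp add: g_def scale_def)
  have p: "\<bar>m\<^sup>2 - D * n\<^sup>2\<bar> = g * p_of D m n" and r: "2 * m * n = g * r_of D m n"
    and q: "m\<^sup>2 + D * n\<^sup>2 = g * q_of D m n"
    unfolding p_of_def r_of_def q_of_def g_def using scale_dvd[of D m n] by simp_all
  have "\<bar>m\<^sup>2 - D * n\<^sup>2\<bar>\<^sup>2 + D * (2 * m * n)\<^sup>2 = (m\<^sup>2 + D * n\<^sup>2)\<^sup>2"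
    by (simp add: power2_eq_square algebra_simps)
  then have "g\<^sup>2 * ((p_of D m n)\<^sup>2 + D * (r_of D m n)\<^sup>2) = g\<^sup>2 * (q_of D m n)\<^sup>2"
    unfolding p q r by (simp add: power_mult_distrib algebra_simps)
  then show ?thesis using g by simp
qed

definition mn_set :: "int \<Rightarrow> int \<Rightarrow> (int \<times> int) set" where
  "mn_set D M = {(m, n). 0 < m \<and> 0 < n \<and> gcd m n = 1 \<and>
     sqrt (real_of_int D / 3) \<le> real_of_int m / real_of_int n \<and>
     real_of_int m / real_of_int n \<le> sqrt (3 * real_of_int D) \<and>
     r_of D m n dvd M}"

definition mn_maximizer :: "int \<Rightarrow> int \<Rightarrow> int \<Rightarrow> int \<Rightarrow> bool" where
  "mn_maximizer D M m n \<longleftrightarrow>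
     is_arg_max (\<lambda>(m, n). real_of_int m / real_of_int n + real_of_int D * (real_of_int n / real_of_int m))
       (\<lambda>x. x \<in> mn_set D M) (m, n)"


section \<open>Computations\<close>

text \<open>The assertion that something can be found in finitely many steps is expressed by a program
  in a while language over the integers, with a small-step semantics. One step evaluates one
  arithmetic or Boolean expression, or discards a finished first half of a sequence.\<close>

type_synonym state = "string \<Rightarrow> int"

datatype aexp = Num int | Var string | Plus aexp aexp | Minus aexp aexp | Times aexp aexp
  | Div aexp aexp | Mod aexp aexp

primrec aval :: "aexp \<Rightarrow> state \<Rightarrow> int" where
  "aval (Num i) s = i"
| "aval (Var x) s = s x"
| "aval (Plus a b) s = aval a s + aval b s"
| "aval (Minus a b) s = aval a s - aval b s"
| "aval (Times a b) s = aval a s * aval b s"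
| "aval (Div a b) s = aval a s div aval b s"
| "aval (Mod a b) s = aval a s mod aval b s"

datatype bexp = Less aexp aexp | Neg bexp | Conj bexp bexp

primrec bval :: "bexp \<Rightarrow> state \<Rightarrow> bool" where
  "bval (Less a b) s \<longleftrightarrow> aval a s < aval b s"
| "bval (Neg b) s \<longleftrightarrow> \<not> bval b s"
| "bval (Conj b b') s \<longleftrightarrow> bval b s \<and> bval b' s"

datatype com = Skip | Assign string aexp | Seq com com | Cond bexp com com | While bexp com

inductive step :: "com \<times> state \<Rightarrow> com \<times> state \<Rightarrow> bool" where
  Assign: "step (Assign x a, s) (Skip, s(x := aval a s))"
| Seq1: "step (Seq Skip c, s) (c, s)"
| Seq2: "step (c1, s) (c1', s') \<Longrightarrow> step (Seq c1 c2, s) (Seq c1' c2, s')"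
| CondTrue: "bval b s \<Longrightarrow> step (Cond b c1 c2, s) (c1, s)"
| CondFalse: "\<not> bval b s \<Longrightarrow> step (Cond b c1 c2, s) (c2, s)"
| WhileTrue: "bval b s \<Longrightarrow> step (While b c, s) (Seq c (While b c), s)"
| WhileFalse: "\<not> bval b s \<Longrightarrow> step (While b c, s) (Skip, s)"

definition halts_after :: "com \<Rightarrow> state \<Rightarrow> nat \<Rightarrow> state \<Rightarrow> bool" where
  "halts_after c s j t \<longleftrightarrow> (step ^^ j) (c, s) (Skip, t)"

definition input :: "int \<Rightarrow> int \<Rightarrow> state" where
  "input M D = (\<lambda>_. 0)(''M'' := M, ''D'' := D)"

end

theory Submission
  imports Defs
begin

text \<open>Two independent minimal vectors \<open>u\<close>, \<open>v\<close> of a planar integral lattice generate it, so up to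
  isometry an IWR lattice of determinant \<open>M \<surd>D\<close> is a pair of integers \<open>a = u \<bullet> u\<close> and
  \<open>b = \<bar>u \<bullet> v\<bar>\<close> with \<open>0 \<le> 2b \<le> a\<close> and \<open>a\<^sup>2 - b\<^sup>2 = D M\<^sup>2\<close>; its minimal norm is \<open>a\<close>.
  Dividing by \<open>k = gcd(a, b, M)\<close> leaves a primitive solution of \<open>p\<^sup>2 + D r\<^sup>2 = q\<^sup>2\<close>. There \<open>q + p\<close> and
  \<open>q - p\<close> are coprime up to a factor 2 and their product is \<open>D r\<^sup>2\<close>, which gives the
  parametrization by \<open>(m, n)\<close>. Since \<open>a = M q / r = M/2 (m/n + D n/m)\<close>, maximizing the objective
  on \<open>mn(M)\<close> maximizes the minimal norm. The pair with the largest \<open>a\<close> is found by a search,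
  because \<open>a \<le> 2 D M\<close>.\<close>

section \<open>Primitive solutions of \<open>p\<^sup>2 + D r\<^sup>2 = q\<^sup>2\<close>\<close>

text \<open>Over the naturals a coprime factor of a square is itself a square, with no units to
  track. The positive signs let this transfer to the integers and fix the sign of
  \<open>s = x * y\<close>.\<close>

lemma coprime_mult_eq_squareE:
  fixes u v s :: int
  assumes "coprime u v" "u * v = s\<^sup>2" "0 < u" "0 < v" "0 < s"
  obtains x y where "0 < x" "0 < y" "u = x\<^sup>2" "v = y\<^sup>2" "s = x * y"
proof -
  have "int (nat u * nat v) = int ((nat s)\<^sup>2)" using assms by simp
  then have "nat u * nat v = (nat s)\<^sup>2" by linarith
  then have "is_nth_power 2 (nat u * nat v)" by (metis is_nth_powerI)
  moreover have "coprime (nat u) (nat v)"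
    using assms coprime_int_iff[of "nat u" "nat v"] by simp
  ultimately have "is_nth_power 2 (nat u)" "is_nth_power 2 (nat v)"
    using is_nth_power_mult_coprime_natD assms by simp_all
  then obtain a b where ab: "nat u = a\<^sup>2" "nat v = b\<^sup>2"
    by (auto simp: is_nth_power_def)
  have u: "u = (int a)\<^sup>2" and v: "v = (int b)\<^sup>2"
    using assms ab by (metis nat_eq_iff order_less_le_trans less_imp_le of_nat_power)+
  have "s = int a * int b"
    by (rule power2_eq_imp_eq) (use assms u v in \<open>simp_all add: power_mult_distrib\<close>)
  moreover have "a \<noteq> 0" "b \<noteq> 0" using u v assms by auto
  ultimately show thesis using that[of "int a" "int b"] u v by simp
qed

text \<open>Since \<open>D\<close> divides \<open>u * v\<close>, it splits as \<open>g * d\<close>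
  with \<open>g\<close> dividing \<open>u\<close> and \<open>d\<close> dividing \<open>v\<close>.
  The cofactors are still coprime and multiply to a square, so both are squares.\<close>

lemma coprime_mult_eq_mult_squareE:
  fixes u v s D :: int
  assumes "coprime u v" "u * v = D * s\<^sup>2" "0 < u" "0 < v" "0 < s" "0 < D"
  obtains g d x y where "0 < g" "0 < d" "0 < x" "0 < y" "D = g * d"
    "u = g * x\<^sup>2" "v = d * y\<^sup>2" "s = x * y"
proof -
  have "D dvd u * v" using assms by simp
  from division_decomp[OF this] obtain g0 d0 where gd0: "D = g0 * d0" "g0 dvd u" "d0 dvd v"
    by blast
  \<comment> \<open>The decomposition does not control signs. As \<open>D\<close> is positive,
    absolute values keep the product.\<close>
  define g d where "g = \<bar>g0\<bar>" and "d = \<bar>d0\<bar>"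
  have gd: "D = g * d" "g dvd u" "d dvd v" using gd0 \<open>0 < D\<close> by (auto simp: g_def d_def simp flip: abs_mult)
  have pos: "0 < g" "0 < d" using gd0 \<open>0 < D\<close> by (auto simp: g_def d_def)
  obtain u' v' where uv: "u = g * u'" "v = d * v'" using gd by (elim dvdE)
  have pos': "0 < u'" "0 < v'" using uv assms pos by (simp_all add: zero_less_mult_iff)
  have "(g * d) * (u' * v') = (g * d) * s\<^sup>2" using assms uv gd by (simp add: mult_ac)
  then have "u' * v' = s\<^sup>2" using pos by simp
  moreover have "coprime u' v'" using assms(1) uv by simp
  ultimately obtain x y where "0 < x" "0 < y" "u' = x\<^sup>2" "v' = y\<^sup>2" "s = x * y"
    using pos' assms coprime_mult_eq_squareE by metis
  then show thesis using that pos gd uv by metis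
qed

section \<open>Integer form of the conditions defining \<open>mn_set\<close>\<close>

lemma scale_pos: "0 < D \<Longrightarrow> 0 < scale D m n"
  by (simp add: scale_def)

lemma scale_mult:
  shows "scale D m n * p_of D m n = \<bar>m\<^sup>2 - D * n\<^sup>2\<bar>"
    and "scale D m n * r_of D m n = 2 * m * n"
    and "scale D m n * q_of D m n = m\<^sup>2 + D * n\<^sup>2"
  unfolding p_of_def r_of_def q_of_def using scale_dvd[of D m n] by simp_all

lemma pqr_signs:
  assumes "0 < m" "0 < n" "0 < D"
  shows "0 \<le> p_of D m n" "0 < r_of D m n" "0 < q_of D m n"
proof -
  have "0 < scale D m n * r_of D m n" "0 < scale D m n * q_of D m n"
    "0 \<le> scale D m n * p_of D m n"
    unfolding scale_mult using assms by (simp_all add: add_pos_pos)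
  then show "0 \<le> p_of D m n" "0 < r_of D m n" "0 < q_of D m n"
    using scale_pos[OF assms(3), of m n] by (simp_all add: zero_less_mult_iff zero_le_mult_iff)
qed

text \<open>For nonnegative \<open>X\<close> and \<open>Y\<close>, the inequality 2|X - Y| \<le> X +
  Y says that neither number exceeds three times the other. With X = m^2 and Y = D n^2 this turns
  the bounds on m/n into the condition that the Gram matrix of the lattice is reduced.\<close>

lemma ratio_bounds_iff:
  assumes "0 < m" "0 < n" "0 < D"
  shows "sqrt (real_of_int D / 3) \<le> real_of_int m / real_of_int n \<and>
      real_of_int m / real_of_int n \<le> sqrt (3 * real_of_int D) \<longleftrightarrow>
    2 * p_of D m n \<le> q_of D m n"
proof -
  define t where "t = real_of_int m / real_of_int n"
  have t: "0 \<le> t" "sqrt (t\<^sup>2) = t" using assms by (simp_all add: t_def)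
  have "2 * p_of D m n \<le> q_of D m n \<longleftrightarrow>
      scale D m n * (2 * p_of D m n) \<le> scale D m n * q_of D m n"
    using scale_pos[OF assms(3)] by simp
  also have "\<dots> \<longleftrightarrow> 2 * \<bar>m\<^sup>2 - D * n\<^sup>2\<bar> \<le> m\<^sup>2 + D * n\<^sup>2"
    unfolding mult.left_commute[of _ 2] scale_mult ..
  also have "\<dots> \<longleftrightarrow> D * n\<^sup>2 \<le> 3 * m\<^sup>2 \<and> m\<^sup>2 \<le> 3 * (D * n\<^sup>2)"
    using assms by (auto simp: abs_if)
  also have "\<dots> \<longleftrightarrow> real_of_int (D * n\<^sup>2) \<le> real_of_int (3 * m\<^sup>2) \<and>
      real_of_int (m\<^sup>2) \<le> real_of_int (3 * (D * n\<^sup>2))"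
    by (simp only: of_int_le_iff)
  also have "\<dots> \<longleftrightarrow> real_of_int D / 3 \<le> t\<^sup>2 \<and> t\<^sup>2 \<le> 3 * real_of_int D"
    using assms by (simp add: t_def field_simps)
  also have "\<dots> \<longleftrightarrow> sqrt (real_of_int D / 3) \<le> t \<and> t \<le> sqrt (3 * real_of_int D)"
    using t by (metis real_sqrt_le_iff)
  finally show ?thesis by (simp add: t_def)
qed

lemma mn_set_iff:
  assumes "0 < D"
  shows "(m, n) \<in> mn_set D M \<longleftrightarrow>
    0 < m \<and> 0 < n \<and> coprime m n \<and> 2 * p_of D m n \<le> q_of D m n \<and> r_of D m n dvd M"
  unfolding mn_set_def mem_Collect_eq case_prod_conv coprime_iff_gcd_eq_1
  using ratio_bounds_iff[of m n D] assms by blast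

section \<open>Every reduced solution comes from a pair (m, n)\<close>

text \<open>If a prime \<open>l\<close> divides both factors, then l^2 divides
  \<open>D * r^2\<close>. As \<open>l\<close> does not divide \<open>r\<close>, l^2 divides
  \<open>D\<close>, against squarefreeness.\<close>

lemma squarefree_coprime_parts:
  fixes a b r D :: int
  assumes "squarefree D" "a * b = D * r\<^sup>2" "\<And>l. prime l \<Longrightarrow> l dvd a \<Longrightarrow> l dvd b \<Longrightarrow> \<not> l dvd r"
    "a \<noteq> 0"
  shows "coprime a b"
proof (rule ccontr)
  assume "\<not> coprime a b"
  then have "\<not> is_unit (gcd a b)" by (simp only: is_unit_gcd not_False_eq_True)
  moreover have "gcd a b \<noteq> 0" using assms(4) by simp
  ultimately obtain l where "prime l" "l dvd gcd a b" using prime_divisorE by blast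
  then have l: "prime l" "l dvd a" "l dvd b" by simp_all
  then have "\<not> l dvd r" using assms(3) by blast
  then have "coprime (l\<^sup>2) (r\<^sup>2)" using l(1) by (simp add: prime_imp_coprime)
  moreover have "l\<^sup>2 dvd a * b" unfolding power2_eq_square using l by (intro mult_dvd_mono)
  then have "l\<^sup>2 dvd D * r\<^sup>2" unfolding assms(2) .
  ultimately have "l\<^sup>2 dvd D" by (simp add: coprime_dvd_mult_left_iff)
  then have "is_unit l" using assms(1) squarefreeD by blast
  then show False using l(1) by (meson not_prime_unit)
qed

text \<open>The coprime factors are q + p and q - p, halved if they are even. Writing them as u = g
  x^2 and v = d y^2 with D = g d gives the pair m = g x, n = y, for which gcd(m, D) = g. Whether
  halving took place is exactly what the exponent \<open>e_exp\<close> records.\<close>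

lemma primitive_solution_param:
  fixes p q r D :: int
  assumes "0 \<le> p" "0 < q" "0 < r" "0 < D" "squarefree D" and eq: "p\<^sup>2 + D * r\<^sup>2 = q\<^sup>2"
    and prim: "gcd (gcd q p) r = 1"
  obtains m n where "0 < m" "0 < n" "coprime m n"
    "p = p_of D m n" "q = q_of D m n" "r = r_of D m n"
proof -
  have no_prime: False if "prime l" "l dvd p" "l dvd q" "l dvd r" for l
  proof -
    have "l dvd gcd (gcd q p) r" using that by simp
    then show False using prim that(1) by (simp add: not_prime_unit)
  qed
  have "p\<^sup>2 < q\<^sup>2" using eq assms by (smt (verit) mult_pos_pos zero_less_power)
  then have "p < q" using assms by (simp add: power2_less_imp_less)
  obtain u v s where uvs: "coprime u v" "u * v = D * s\<^sup>2" "0 < u" "0 < v" "0 < s" "v \<le> u"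
    and cases: "odd u \<and> odd v \<and> 2 * p = u - v \<and> 2 * q = u + v \<and> r = s \<or>
      (odd u \<longleftrightarrow> even v) \<and> p = u - v \<and> q = u + v \<and> r = 2 * s"
  proof (cases "even (q + p)")
    case False
    show thesis
    proof (rule that)
      show "(q + p) * (q - p) = D * r\<^sup>2" using eq by (simp add: algebra_simps power2_eq_square)
      then show "coprime (q + p) (q - p)"
      proof (rule squarefree_coprime_parts[OF assms(5)])
        fix l :: int assume l: "prime l" "l dvd q + p" "l dvd q - p"
        \<comment> \<open>The prime 2 is excluded because q + p is odd here, so \<open>l\<close> can
          be cancelled from 2q and 2p.\<close>
        have "l \<noteq> 2" using l False by blast
        moreover have "2 * q = (q + p) + (q - p)" "2 * p = (q + p) - (q - p)" by simp_all
        then have "l dvd 2 * q" "l dvd 2 * p" using l by (metis dvd_add, metis dvd_diff)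
        ultimately have "l dvd q" "l dvd p"
          using l(1) by (metis prime_dvd_mult_iff primes_dvd_imp_eq two_is_prime)+
        then show "\<not> l dvd r" using no_prime l by blast
      qed (use assms in simp)
      show "odd (q + p) \<and> odd (q - p) \<and> 2 * p = q + p - (q - p) \<and> 2 * q = q + p + (q - p) \<and> r = r \<or>
        (odd (q + p) \<longleftrightarrow> even (q - p)) \<and> p = q + p - (q - p) \<and> q = q + p + (q - p) \<and> r = 2 * r"
        using False by simp
    qed (use assms \<open>p < q\<close> in auto)
  next
    case True
    then obtain u where u: "q + p = 2 * u" by blast
    define v where "v = q - u"
    have qp: "q = u + v" "p = u - v" using u by (simp_all add: v_def)
    \<comment> \<open>Both factors are even, so 4 divides \<open>D * r^2\<close>; an odd
      \<open>r\<close> would force 4 to divide the squarefree \<open>D\<close>.\<close>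
    have "even r"
    proof (rule ccontr)
      assume "odd r"
      then have "coprime (2\<^sup>2) (r\<^sup>2)"
        unfolding coprime_power_left_iff coprime_power_right_iff by simp
      moreover have "2\<^sup>2 * (u * v) = D * r\<^sup>2" using eq qp by (simp add: algebra_simps power2_eq_square)
      then have "2\<^sup>2 dvd D * r\<^sup>2" by (metis dvd_triv_left)
      ultimately have "2\<^sup>2 dvd D" by (simp only: coprime_dvd_mult_left_iff)
      then have "is_unit (2::int)" using assms(5) squarefreeD by blast
      then show False by simp
    qed
    then obtain s where s: "r = 2 * s" by blast
    have uv: "u * v = D * s\<^sup>2" using eq qp s by (simp add: algebra_simps power2_eq_square)
    have pos: "0 < u" "0 < v" using u \<open>p < q\<close> assms qp by linarith+
    have cop: "coprime u v"
    proof (rule squarefree_coprime_parts[OF assms(5) uv])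
      fix l assume "prime l" "l dvd u" "l dvd v"
      then show "\<not> l dvd s" using no_prime[of l] by (auto simp: qp s)
    qed (use pos in simp)
    \<comment> \<open>If both were odd, then u - v, u + v and 2s, that is \<open>p\<close>,
      \<open>q\<close> and \<open>r\<close>, would all be even, against primitivity. If both were
      even, they would not be coprime.\<close>
    have "odd u \<longleftrightarrow> even v"
    proof -
      have "\<not> (odd u \<and> odd v)" using no_prime[of 2] qp s by auto
      moreover have "\<not> (even u \<and> even v)" using cop by auto
      ultimately show ?thesis by blast
    qed
    then show thesis using that[of u v s] uv pos cop qp s assms by auto
  qed
  obtain g d x y where gdxy: "0 < g" "0 < d" "0 < x" "0 < y" "D = g * d"
    "u = g * x\<^sup>2" "v = d * y\<^sup>2" "s = x * y"
    using coprime_mult_eq_mult_squareE uvs \<open>0 < D\<close> by metis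
  have cop: "coprime x d" "coprime g y" "coprime x y"
    using uvs(1) by (simp_all add: gdxy)
  have "coprime (g * x) y" using cop by simp
  have gcd: "gcd (g * x) D = g" using cop gdxy by (simp add: gcd_mult_left)
  have sc: "scale D (g * x) y * p = \<bar>(g * x)\<^sup>2 - D * y\<^sup>2\<bar> \<and>
    scale D (g * x) y * q = (g * x)\<^sup>2 + D * y\<^sup>2 \<and> scale D (g * x) y * r = 2 * (g * x) * y"
  proof -
    have 1: "(g * x)\<^sup>2 - D * y\<^sup>2 = g * (u - v)" "(g * x)\<^sup>2 + D * y\<^sup>2 = g * (u + v)"
      "g * x * y = g * s"
      by (simp_all add: gdxy power2_eq_square algebra_simps)
    \<comment> \<open>The ordering \<open>v \<le> u\<close>, which reflects
      \<open>0 \<le> p\<close>, removes the absolute value.\<close>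
    then have 2: "\<bar>(g * x)\<^sup>2 - D * y\<^sup>2\<bar> = g * (u - v)" using uvs gdxy by simp
    show ?thesis using cases
    proof
      assume *: "odd u \<and> odd v \<and> 2 * p = u - v \<and> 2 * q = u + v \<and> r = s"
      \<comment> \<open>Both \<open>u\<close> and \<open>v\<close> are odd only if \<open>D\<close>,
        \<open>g * x\<close> and \<open>y\<close> are all odd, which is the case of exponent
        1.\<close>
      then have "e_exp (g * x) y D = 1" by (simp add: e_exp_def gdxy)
      then show ?thesis unfolding scale_def gcd 2 1(2) using * 1(3) by (auto simp: mult.assoc)
    next
      assume *: "(odd u \<longleftrightarrow> even v) \<and> p = u - v \<and> q = u + v \<and> r = 2 * s"
      then have "e_exp (g * x) y D = 0" by (auto simp: e_exp_def gdxy)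
      then show ?thesis unfolding scale_def gcd 2 1(2) using * 1(3) by auto
    qed
  qed
  have "scale D (g * x) y \<noteq> 0" using scale_pos[OF \<open>0 < D\<close>, of "g * x" y] by simp
  then have "p = p_of D (g * x) y" "q = q_of D (g * x) y" "r = r_of D (g * x) y"
    unfolding p_of_def q_of_def r_of_def using sc by (metis nonzero_mult_div_cancel_left)+
  then show thesis using that[of "g * x" y] gdxy \<open>coprime (g * x) y\<close> by simp
qed

text \<open>Dividing by the common gcd makes the solution primitive and keeps the equation and the
  inequality \<open>2 * b \<le> a\<close>, which becomes the bound on m/n.\<close>

lemma solution_param:
  fixes a b M D :: int
  assumes "0 \<le> b" "2 * b \<le> a" "0 < M" "0 < D" "squarefree D" and eq: "a\<^sup>2 - b\<^sup>2 = D * M\<^sup>2"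
  obtains m n where "(m, n) \<in> mn_set D M" "a = gcd (gcd a b) M * q_of D m n"
    "b = gcd (gcd a b) M * p_of D m n" "M = gcd (gcd a b) M * r_of D m n"
proof -
  define k where "k = gcd (gcd a b) M"
  have "0 < k" using \<open>0 < M\<close> by (simp add: k_def)
  have dvd: "k dvd a" "k dvd b" "k dvd M"
    unfolding k_def by (meson gcd_dvd1 gcd_dvd2 dvd_trans)+
  then obtain q p r where pqr: "a = k * q" "b = k * p" "M = k * r" by (auto elim!: dvdE)
  have "k * gcd (gcd q p) r = k * 1"
    using \<open>0 < k\<close> k_def[unfolded pqr] by (simp add: gcd_mult_left)
  then have prim: "gcd (gcd q p) r = 1" using \<open>0 < k\<close> by simp
  have "k\<^sup>2 * (q\<^sup>2 - p\<^sup>2) = k\<^sup>2 * (D * r\<^sup>2)"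
    using eq by (simp add: pqr power_mult_distrib algebra_simps)
  then have eq': "p\<^sup>2 + D * r\<^sup>2 = q\<^sup>2" using \<open>0 < k\<close> by simp
  have "0 \<le> p" "2 * p \<le> q" "0 < r"
    using assms(1-3) \<open>0 < k\<close> by (simp_all add: pqr zero_le_mult_iff zero_less_mult_iff mult.left_commute[of 2])
  moreover from this have "0 < q" using eq' \<open>0 < D\<close>
    by (smt (verit) mult_pos_pos zero_less_power power_zero_numeral)
  ultimately obtain m n where mn: "0 < m" "0 < n" "coprime m n"
    "p = p_of D m n" "q = q_of D m n" "r = r_of D m n"
    using primitive_solution_param eq' prim assms(4,5) by metis
  have "(m, n) \<in> mn_set D M"
    using mn pqr \<open>2 * p \<le> q\<close> by (simp add: mn_set_iff[OF \<open>0 < D\<close>])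
  then show thesis using that mn pqr unfolding k_def by metis
qed

text \<open>The common factor \<open>scale\<close> cancels in q/r. Since M = k r, the objective is
  2/M times the minimal norm k q.\<close>

lemma objective_eq:
  assumes "0 < m" "0 < n" "0 < D"
  shows "real_of_int m / real_of_int n + real_of_int D * (real_of_int n / real_of_int m) =
    2 * (real_of_int (q_of D m n) / real_of_int (r_of D m n))"
proof -
  define g where "g = real_of_int (scale D m n)"
  have "g * real_of_int (q_of D m n) = real_of_int (m\<^sup>2 + D * n\<^sup>2)"
    "g * real_of_int (r_of D m n) = real_of_int (2 * m * n)" "g \<noteq> 0"
    using scale_mult[of D m n] scale_pos[OF assms(3), of m n] unfolding g_def
    by (metis of_int_mult, metis of_int_mult, simp)
  then have "real_of_int (q_of D m n) / real_of_int (r_of D m n) =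
      real_of_int (m\<^sup>2 + D * n\<^sup>2) / real_of_int (2 * m * n)"
    by (metis mult_divide_mult_cancel_left)
  then show ?thesis using assms by (simp add: field_simps power2_eq_square)
qed

section \<open>Planar integral well-rounded lattices\<close>

lemma det_Ints:
  fixes A :: "'a::comm_ring_1^'n^'n"
  assumes "\<And>i j. A $ i $ j \<in> \<int>"
  shows "det A \<in> \<int>"
  unfolding det_def using assms by (intro Ints_sum Ints_mult Ints_prod Ints_of_int) auto

lemma axis_Ints: "axis k (1::real) $ i \<in> \<int>"
  by (simp add: axis_def)

text \<open>Inclusion gives A = B U with an integer matrix \<open>U\<close>. Its determinant is a
  nonzero integer, hence at least 1 in absolute value. Applied in both directions, this makes the
  arbitrary choice in \<open>lattice_det\<close> harmless.\<close>

lemma abs_det_le_of_lattice_subset: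
  fixes A B :: "real^'n^'n"
  assumes "invertible A" "lattice_of A \<subseteq> lattice_of B"
  shows "\<bar>det B\<bar> \<le> \<bar>det A\<bar>"
proof -
  have "\<exists>z. column k A = B *v z \<and> (\<forall>i. z $ i \<in> \<int>)" for k
  proof -
    have "column k A \<in> lattice_of A"
      unfolding lattice_of_def using axis_Ints by (auto simp flip: matrix_vector_mult_basis)
    then show ?thesis using assms(2) by (auto simp: lattice_of_def)
  qed
  then obtain z :: "'n \<Rightarrow> real^'n" where z: "\<And>k. column k A = B *v z k" "\<And>k i. z k $ i \<in> \<int>" by metis
  define U :: "real^'n^'n" where "U = (\<chi> i k. z k $ i)"
  have "A = B ** U"
    using z(1) by (auto simp: vec_eq_iff column_def U_def matrix_matrix_mult_def matrix_vector_mult_def)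
  then have det: "det A = det B * det U" by (simp add: det_mul)
  have "det U \<in> \<int>" using z(2) by (intro det_Ints) (simp add: U_def)
  moreover have "det U \<noteq> 0" using assms(1) det by (auto simp: invertible_det_nz)
  ultimately have "1 \<le> \<bar>det U\<bar>" by (rule Ints_nonzero_abs_ge1)
  then show ?thesis unfolding det abs_mult by (simp add: mult_le_cancel_left1)
qed

lemma lattice_det_eq:
  assumes "basis_matrix A L"
  shows "lattice_det L = \<bar>det A\<bar>"
proof -
  define B where "B = (SOME A. basis_matrix A L)"
  have "basis_matrix B L" unfolding B_def using assms by (rule someI)
  then have "invertible A" "invertible B" "lattice_of A = lattice_of B"
    using assms by (auto simp: basis_matrix_def)
  then have "\<bar>det A\<bar> = \<bar>det B\<bar>" using abs_det_le_of_lattice_subset by (metis order_antisym order_refl)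
  then show ?thesis by (simp add: lattice_det_def B_def)
qed

lemma lattice_of_scaleR: "lattice_of (c *\<^sub>R A) = (\<lambda>x. c *\<^sub>R x) ` lattice_of A"
  by (auto simp: lattice_of_def simp flip: scaleR_matrix_vector_assoc)

lemma matrix_vector_2:
  fixes A :: "real^2^'n"
  shows "A *v z = z $ 1 *\<^sub>R column 1 A + z $ 2 *\<^sub>R column 2 A"
  by (simp add: matrix_vector_mult_def vec_eq_iff column_def sum_2 mult.commute)

lemma lattice_of_2:
  fixes A :: "real^2^2"
  shows "lattice_of A =
    {of_int i *\<^sub>R column 1 A + of_int j *\<^sub>R column 2 A | i j. True}"
proof -
  have "\<exists>z::real^2. (\<forall>i. z $ i \<in> \<int>) \<and> z $ 1 = of_int i \<and> z $ 2 = of_int j" for i j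
    by (rule exI[of _ "vector [of_int i, of_int j]"]) (simp add: forall_2)
  then show ?thesis
    unfolding lattice_of_def matrix_vector_2
    by (auto simp: forall_2 elim!: Ints_cases) metis+
qed

text \<open>This is Lagrange's identity: the squared determinant is the Gram determinant, so
  \<open>a\<close> and \<open>b\<close> alone determine it.\<close>

lemma det_square_Gram_2:
  fixes A :: "real^2^2"
  defines "u \<equiv> column 1 A" and "v \<equiv> column 2 A"
  shows "(det A)\<^sup>2 = (u \<bullet> u) * (v \<bullet> v) - (u \<bullet> v)\<^sup>2"
  by (simp add: u_def v_def det_2 inner_vec_def sum_2 column_def power2_eq_square algebra_simps)

lemma norm_combination:
  fixes u v :: "'a::real_inner"
  assumes "u \<bullet> u = a" "v \<bullet> v = a" "u \<bullet> v = b"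
  shows "(norm (x *\<^sub>R u + y *\<^sub>R v))\<^sup>2 = a * x\<^sup>2 + 2 * b * x * y + a * y\<^sup>2"
  unfolding dot_square_norm[symmetric] using assms inner_commute[of u v]
  by (simp add: inner_add_left inner_add_right power2_eq_square algebra_simps)

lemma min_norm_eqI:
  assumes "x \<in> L" "x \<noteq> 0" "(norm x)\<^sup>2 = a" "\<And>y. y \<in> L \<Longrightarrow> y \<noteq> 0 \<Longrightarrow> a \<le> (norm y)\<^sup>2"
  shows "min_norm L = a"
  unfolding min_norm_def using assms by (intro Least_equality) auto

section \<open>From a reduced Gram matrix to an IWR lattice\<close>

text \<open>A vector i u + j v has squared norm a i^2 + 2 b i j + a j^2, which is at least a (i^2 -
  |i j| + j^2) because 2|b| is at most \<open>a\<close>. The bracket equals (|i| - |j|)^2 + |i| |j|,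
  a positive integer unless i = j = 0. Hence \<open>u\<close> and \<open>v\<close> are
  minimal.\<close>

lemma IWR_of_reduced_basis:
  fixes A :: "real^2^2"
  defines "u \<equiv> column 1 A" and "v \<equiv> column 2 A"
  assumes "u \<bullet> u = of_int a" "v \<bullet> v = of_int a" "u \<bullet> v = of_int b" "0 < a" "2 * \<bar>b\<bar> \<le> a"
  shows "IWR (lattice_of A)" "lattice_det (lattice_of A) = sqrt (of_int (a\<^sup>2 - b\<^sup>2))"
    "min_norm (lattice_of A) = of_int a"
proof -
  let ?L = "lattice_of A"
  have "\<bar>b\<bar> < a" using assms by linarith
  then have "b\<^sup>2 < a\<^sup>2" by (metis abs_ge_zero power2_abs power_strict_mono zero_less_numeral)
  have detsq: "(det A)\<^sup>2 = of_int (a\<^sup>2 - b\<^sup>2)"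
    using det_square_Gram_2[of A] assms(3-5) unfolding u_def v_def by (simp add: power2_eq_square)
  then have "det A \<noteq> 0" using \<open>b\<^sup>2 < a\<^sup>2\<close>
    by (metis diff_gt_0_iff_gt of_int_eq_0_iff order_less_irrefl zero_power2)
  then have basis: "basis_matrix A ?L" by (simp add: basis_matrix_def invertible_det_nz)
  show "lattice_det ?L = sqrt (of_int (a\<^sup>2 - b\<^sup>2))"
    unfolding lattice_det_eq[OF basis] using detsq by (metis real_sqrt_abs)
  have in_L: "u \<in> ?L" "v \<in> ?L"
    unfolding u_def v_def lattice_of_def using axis_Ints by (auto simp flip: matrix_vector_mult_basis)
  have norms: "(norm u)\<^sup>2 = of_int a" "(norm v)\<^sup>2 = of_int a"
    using assms by (simp_all add: dot_square_norm[symmetric])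
  have nz: "u \<noteq> 0" "v \<noteq> 0" using assms by auto
  show min: "min_norm ?L = of_int a"
  proof (rule min_norm_eqI)
    fix y assume "y \<in> ?L" "y \<noteq> 0"
    then obtain i j :: int where y: "y = of_int i *\<^sub>R u + of_int j *\<^sub>R v"
      unfolding lattice_of_2 u_def v_def by auto
    have ij: "i \<noteq> 0 \<or> j \<noteq> 0" using \<open>y \<noteq> 0\<close> y by auto
    have "(norm y)\<^sup>2 = of_int (a * i\<^sup>2 + 2 * b * i * j + a * j\<^sup>2)"
      unfolding y norm_combination[OF assms(3-5)] by simp
    moreover have "a \<le> a * i\<^sup>2 + 2 * b * i * j + a * j\<^sup>2"
    proof -
      have "1 \<le> i\<^sup>2 - \<bar>i * j\<bar> + j\<^sup>2"
      proof -
        have "0 < (\<bar>i\<bar> - \<bar>j\<bar>)\<^sup>2 + \<bar>i\<bar> * \<bar>j\<bar>"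
        proof (cases "\<bar>i\<bar> = \<bar>j\<bar>")
          case True
          then have "i \<noteq> 0" "j \<noteq> 0" using ij by auto
          then show ?thesis by (simp add: add_nonneg_pos)
        qed (simp add: add_pos_nonneg)
        then show ?thesis by (simp add: power2_eq_square algebra_simps abs_mult)
      qed
      then have "a * 1 \<le> a * (i\<^sup>2 - \<bar>i * j\<bar> + j\<^sup>2)" using assms by (intro mult_left_mono) auto
      moreover have "\<bar>2 * b * (i * j)\<bar> \<le> a * \<bar>i * j\<bar>"
        using mult_right_mono[OF assms(7), of "\<bar>i * j\<bar>"] by (simp add: abs_mult mult.assoc)
      ultimately show ?thesis by (simp add: algebra_simps)
    qed
    ultimately show "of_int a \<le> (norm y)\<^sup>2" by (simp only: of_int_le_iff)
  qed (use in_L norms nz in auto)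
  \<comment> \<open>Dependence would be equality in Cauchy-Schwarz, b^2 = a^2, contradicting the
    strict inequality above.\<close>
  have "u \<notin> span {v}"
  proof
    assume "u \<in> span {v}"
    then obtain c where "u = c *\<^sub>R v" by (auto simp: span_singleton)
    then have "real_of_int b = c * of_int a" "real_of_int a = c\<^sup>2 * of_int a"
      using assms(3-5) by (auto simp: power2_eq_square)
    then have "real_of_int (b\<^sup>2) = real_of_int (a\<^sup>2)" by (simp add: power2_eq_square mult_ac)
    then show False using \<open>b\<^sup>2 < a\<^sup>2\<close> by (simp only: of_int_eq_iff)
  qed
  then have "independent {u, v}" "u \<noteq> v" using nz by (auto simp: independent_insert span_base)
  moreover have "{u, v} \<subseteq> minimal_vectors ?L"
    using in_L nz norms min by (auto simp: minimal_vectors_def)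
  ultimately have "well_rounded ?L"
    unfolding well_rounded_def full_lattice_def using basis
    by (intro conjI exI[of _ "{u, v}"] exI[of _ A]) auto
  moreover have "integral_lattice ?L"
  proof -
    have "(transpose A ** A) $ i $ j = column i A \<bullet> column j A" for i j
      by (simp add: matrix_matrix_mult_def transpose_def column_def inner_vec_def)
    then have "\<forall>i j. (transpose A ** A) $ i $ j \<in> \<int>"
      using assms(3-5) inner_commute[of v u] by (simp add: forall_2 u_def v_def)
    then show ?thesis using basis by (auto simp: integral_lattice_def)
  qed
  ultimately show "IWR ?L" by (simp add: IWR_def)
qed

section \<open>From an IWR lattice to a reduced Gram matrix\<close>

lemma lattice_of_add:
  "x \<in> lattice_of A \<Longrightarrow> y \<in> lattice_of A \<Longrightarrow> x + y \<in> lattice_of A"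
  unfolding lattice_of_def by clarsimp (metis matrix_vector_right_distrib vector_add_component Ints_add)

lemma lattice_of_scale_int:
  fixes A :: "real^'n^'n"
  assumes "x \<in> lattice_of A" shows "real_of_int i *\<^sub>R x \<in> lattice_of A"
proof -
  obtain z :: "real^'n" where z: "x = A *v z" "\<forall>i. z $ i \<in> \<int>" using assms by (auto simp: lattice_of_def)
  show ?thesis unfolding lattice_of_def z(1)
    using z(2) by (auto intro!: exI[of _ "real_of_int i *\<^sub>R z"] simp: matrix_vector_mult_scaleR)
qed

lemma integral_lattice_inner:
  fixes L :: "(real^'n) set"
  assumes "integral_lattice L" "x \<in> L" "y \<in> L"
  shows "x \<bullet> y \<in> \<int>"
proof -
  obtain A where A: "L = lattice_of A" "\<And>i j. (transpose A ** A) $ i $ j \<in> \<int>"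
    using assms(1) by (auto simp: integral_lattice_def basis_matrix_def)
  obtain z w :: "real^'n" where zw: "x = A *v z" "y = A *v w" "\<forall>i. z $ i \<in> \<int>" "\<forall>i. w $ i \<in> \<int>"
    using assms(2,3) A(1) by (auto simp: lattice_of_def)
  have "x \<bullet> y = (z v* transpose A) \<bullet> y" by (simp add: zw(1) vector_transpose_matrix)
  also have "\<dots> = z \<bullet> ((transpose A ** A) *v w)"
    unfolding zw(2) dot_lmul_matrix matrix_vector_mul_assoc ..
  also have "\<dots> = (\<Sum>i\<in>UNIV. z $ i * (\<Sum>j\<in>UNIV. (transpose A ** A) $ i $ j * w $ j))"
    by (simp add: inner_vec_def matrix_vector_mult_def)
  also have "\<dots> \<in> \<int>" using zw A(2) by (intro Ints_sum Ints_mult) auto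
  finally show ?thesis .
qed

text \<open>A \<open>LEAST\<close> over the reals is informative only if the minimum is attained.
  Here squared norms are naturals, so well-ordering provides a least one.\<close>

lemma integral_lattice_min_norm_le:
  assumes "integral_lattice L" "x \<in> L" "x \<noteq> 0"
  shows "min_norm L \<le> (norm x)\<^sup>2"
proof -
  define V where "V = (\<lambda>x. (norm x)\<^sup>2) ` (L - {0})"
  have nat: "\<exists>n::nat. a = real n" if a: "a \<in> V" for a
  proof -
    obtain y where "y \<in> L" "a = (norm y)\<^sup>2" using a unfolding V_def by blast
    then have y: "y \<in> L" "a = y \<bullet> y" by (simp_all only: power2_norm_eq_inner)
    then show ?thesis using integral_lattice_inner[OF assms(1), of y y] by (metis Ints_cases
      inner_ge_zero of_int_0_le_iff of_int_of_nat_eq zero_le_imp_eq_int)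
  qed
  have xV: "(norm x)\<^sup>2 \<in> V" using assms by (auto simp: V_def)
  define n where "n = (LEAST n::nat. real n \<in> V)"
  have "\<exists>n. real n \<in> V" using nat xV by metis
  then have "real n \<in> V" unfolding n_def by (rule LeastI_ex)
  moreover have "real n \<le> a" if "a \<in> V" for a
    using nat[OF that] that unfolding n_def by (auto intro: Least_le)
  ultimately have "min_norm L = real n"
    unfolding min_norm_def V_def[symmetric] by (intro Least_equality)
  then show ?thesis using \<open>\<And>a. a \<in> V \<Longrightarrow> real n \<le> a\<close>[OF xV] by simp
qed

text \<open>The nonzero vectors u + v and u - v have squared norm at least \<open>a\<close>, which
  bounds |u . v|. For generation, any lattice vector is reduced modulo \<open>u\<close> and
  \<open>v\<close> to a remainder of squared norm at most 3a/4, which minimality forces to be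
  0.\<close>

lemma shortest_independent_pair_generates:
  fixes A :: "real^2^2"
  defines "L \<equiv> lattice_of A"
  assumes uv: "u \<in> L" "v \<in> L" "independent {u, v}" "u \<noteq> v"
    and norms: "u \<bullet> u = a" "v \<bullet> v = a"
    and min: "\<And>x. x \<in> L \<Longrightarrow> x \<noteq> 0 \<Longrightarrow> a \<le> (norm x)\<^sup>2"
  shows "2 * \<bar>u \<bullet> v\<bar> \<le> a"
    and "\<exists>B. basis_matrix B L \<and> column 1 B = u \<and> column 2 B = v"
proof -
  define b where "b = u \<bullet> v"
  have comb: "of_int i *\<^sub>R u + of_int j *\<^sub>R v \<in> L" for i j
    using uv unfolding L_def by (intro lattice_of_add lattice_of_scale_int)
  have "u + v \<noteq> 0" "u - v \<noteq> 0" "u \<noteq> 0"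
  proof -
    have "u \<noteq> c *\<^sub>R v" for c
      using uv by (auto simp: independent_insert span_singleton)
    from this[of "-1"] this[of 1] this[of 0]
    show "u + v \<noteq> 0" "u - v \<noteq> 0" "u \<noteq> 0" by (simp_all add: eq_neg_iff_add_eq_0)
  qed
  have "0 < a" using norms(1) \<open>u \<noteq> 0\<close> by auto
  note nc = norm_combination[OF norms refl]
  have "a \<le> (norm (u + v))\<^sup>2" "a \<le> (norm (u - v))\<^sup>2"
    using comb[of 1 1] comb[of 1 "-1"] \<open>u + v \<noteq> 0\<close> \<open>u - v \<noteq> 0\<close> by (auto intro: min)
  then have "a \<le> 2 * a + 2 * b" "a \<le> 2 * a - 2 * b"
    using nc[of 1 1] nc[of 1 "-1"] by (simp_all add: b_def)
  then show b: "2 * \<bar>u \<bullet> v\<bar> \<le> a" unfolding b_def by linarith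
  define B :: "real^2^2" where "B = transpose (vector [u, v])"
  have colB: "column 1 B = u" "column 2 B = v" by (simp_all add: B_def column_transpose row_def)
  have "(u \<bullet> v)\<^sup>2 < a\<^sup>2" using b \<open>0 < a\<close> abs_le_square_iff[of a "u \<bullet> v"] by linarith
  then have "det B \<noteq> 0"
    using det_square_Gram_2[of B] norms unfolding colB by (auto simp: power2_eq_square)
  then have inv: "invertible B" by (simp add: invertible_det_nz)
  have "lattice_of B = L"
  proof
    show "lattice_of B \<subseteq> L" unfolding lattice_of_2 colB using comb by auto
    show "L \<subseteq> lattice_of B"
    proof
      fix x assume "x \<in> L"
      obtain z where "x = B *v z"
        using inv by (metis invertible_def matrix_vector_mul_assoc matrix_vector_mul_lid)
      then have x: "x = z $ 1 *\<^sub>R u + z $ 2 *\<^sub>R v" by (simp add: matrix_vector_2 colB)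
      \<comment> \<open>Rounding to the nearest integer, rather than down, gives the bound 1/2 that
        makes the remainder short.\<close>
      define s t where "s = z $ 1 - of_int (round (z $ 1))" and "t = z $ 2 - of_int (round (z $ 2))"
      have st: "\<bar>s\<bar> \<le> 1 / 2" "\<bar>t\<bar> \<le> 1 / 2"
        using of_int_round_abs_le[of "z $ 1"] of_int_round_abs_le[of "z $ 2"]
        by (simp_all add: s_def t_def abs_minus_commute)
      define y where "y = x + (of_int (- round (z $ 1)) *\<^sub>R u + of_int (- round (z $ 2)) *\<^sub>R v)"
      have "y \<in> L" unfolding y_def L_def
        using \<open>x \<in> L\<close>[unfolded L_def] comb[unfolded L_def] by (rule lattice_of_add)
      have y: "y = s *\<^sub>R u + t *\<^sub>R v" by (simp add: y_def x s_def t_def algebra_simps)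
      have "(norm y)\<^sup>2 = a * s\<^sup>2 + 2 * b * (s * t) + a * t\<^sup>2"
        unfolding y nc b_def by (simp add: mult.assoc)
      \<comment> \<open>Each of the three terms is at most a/4; for the mixed one, 2|b| is at most
        \<open>a\<close> and |s t| is at most 1/4.\<close>
      also have "\<dots> \<le> a * (1/4) + a * (1/4) + a * (1/4)"
      proof -
        have sq: "s\<^sup>2 \<le> 1/4" "t\<^sup>2 \<le> 1/4"
          using abs_le_square_iff[of s "1/2"] abs_le_square_iff[of t "1/2"] st
          by (simp_all add: power2_eq_square)
        have "\<bar>s * t\<bar> \<le> 1/2 * (1/2)" unfolding abs_mult using st by (intro mult_mono) auto
        then have "(2 * \<bar>b\<bar>) * \<bar>s * t\<bar> \<le> a * (1/4)"
          using b[folded b_def] \<open>0 < a\<close> by (intro mult_mono[of _ a]) simp_all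
        moreover have "2 * b * (s * t) \<le> (2 * \<bar>b\<bar>) * \<bar>s * t\<bar>"
          using abs_ge_self[of "b * (s * t)"] by (simp add: abs_mult)
        ultimately have "2 * b * (s * t) \<le> a * (1/4)" by (rule order_trans[rotated])
        moreover have "a * s\<^sup>2 \<le> a * (1/4)" "a * t\<^sup>2 \<le> a * (1/4)"
          by (intro mult_left_mono sq less_imp_le[OF \<open>0 < a\<close>])+
        ultimately show ?thesis by linarith
      qed
      also have "\<dots> < a" using \<open>0 < a\<close> by simp
      finally have "y = 0" using min[OF \<open>y \<in> L\<close>] by force
      then have "x = of_int (round (z $ 1)) *\<^sub>R u + of_int (round (z $ 2)) *\<^sub>R v"
        by (simp add: y_def algebra_simps)
      then show "x \<in> lattice_of B" unfolding lattice_of_2 colB by blast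
    qed
  qed
  then show "\<exists>B. basis_matrix B L \<and> column 1 B = u \<and> column 2 B = v"
    using inv colB by (auto simp: basis_matrix_def)
qed

lemma IWR_obtains_solution:
  fixes L :: "(real^2) set"
  assumes "IWR L"
  obtains a b :: int where "0 \<le> b" "2 * b \<le> a" "0 < a"
    "(lattice_det L)\<^sup>2 = of_int (a\<^sup>2 - b\<^sup>2)" "min_norm L = of_int a"
proof -
  have int: "integral_lattice L" using assms by (simp add: IWR_def)
  then obtain A where A: "L = lattice_of A" by (auto simp: integral_lattice_def basis_matrix_def)
  obtain S where S: "S \<subseteq> minimal_vectors L" "independent S" "card S = 2"
    using assms by (auto simp: IWR_def well_rounded_def)
  then obtain u v where Suv: "S = {u, v}" "u \<noteq> v" by (auto simp: card_2_iff)
  then have uv: "u \<in> L" "v \<in> L" "u \<noteq> 0" "u \<bullet> u = min_norm L" "v \<bullet> v = min_norm L"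
    using S by (auto simp: minimal_vectors_def dot_square_norm)
  have "min_norm L \<in> \<int>" "u \<bullet> v \<in> \<int>"
    using integral_lattice_inner[OF int] uv by metis+
  then obtain a b where a: "min_norm L = of_int a" and b: "u \<bullet> v = of_int b"
    by (auto elim!: Ints_cases)
  note gen = shortest_independent_pair_generates[of u A v "min_norm L", folded A, OF uv(1,2) _ Suv(2) uv(4,5)
      integral_lattice_min_norm_le[OF int]]
  have "2 * \<bar>real_of_int b\<bar> \<le> of_int a" using gen(1) S Suv a b by simp
  then have "2 * \<bar>b\<bar> \<le> a" by linarith
  obtain B where B: "basis_matrix B L" "column 1 B = u" "column 2 B = v"
    using gen(2) S Suv by auto
  \<comment> \<open>The inner product may be negative. Its absolute value serves as well, since the
    Gram determinant depends only on its square.\<close>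
  have "(lattice_det L)\<^sup>2 = of_int (a\<^sup>2 - \<bar>b\<bar>\<^sup>2)"
    unfolding lattice_det_eq[OF B(1)] power2_abs det_square_Gram_2 B(2,3) uv(4,5) a b
    by (simp add: power2_eq_square)
  moreover have "0 < a"
    using uv(3,4) a by (metis inner_gt_zero_iff of_int_0_less_iff)
  ultimately show thesis using that[of "\<bar>b\<bar>" a] \<open>2 * \<bar>b\<bar> \<le> a\<close> a by simp
qed

section \<open>The search program\<close>

abbreviation steps :: "com \<times> state \<Rightarrow> com \<times> state \<Rightarrow> bool" where
  "steps \<equiv> step\<^sup>*\<^sup>*"

lemma steps_Assign: "steps (Assign x a, s) (Skip, s(x := aval a s))"
  by (rule r_into_rtranclp) (rule step.Assign)

lemma steps_Seq_context:
  assumes "steps (c1, s) (c1', s')"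
  shows "steps (Seq c1 c2, s) (Seq c1' c2, s')"
  using assms
proof (induction rule: rtranclp_induct2)
  case (step c' t' c'' t'')
  then show ?case by (meson step.Seq2 rtranclp.rtrancl_into_rtrancl)
qed simp

lemma steps_Seq:
  assumes "steps (c1, s) (Skip, t)" "steps (c2, t) (Skip, u)"
  shows "steps (Seq c1 c2, s) (Skip, u)"
  using steps_Seq_context[OF assms(1), of c2] assms(2)
  by (meson step.Seq1 converse_rtranclp_into_rtranclp rtranclp_trans)

text \<open>The witness \<open>y0\<close> ensures termination: the counter cannot pass below it, and
  \<open>s v - y0\<close> decreases. The test is described only on states that differ from
  \<open>s\<close> at \<open>v\<close>, the one variable that the body changes, so the lemma serves
  both loops of the program.\<close>

lemma steps_search_down:
  fixes P :: "int \<Rightarrow> bool"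
  assumes "\<And>y. bval b (s(v := y)) \<longleftrightarrow> \<not> P y" and "P y0" "y0 \<le> s v"
  shows "\<exists>y. P y \<and> y \<le> s v \<and> (\<forall>z. P z \<and> z \<le> s v \<longrightarrow> z \<le> y) \<and>
    steps (While b (Assign v (Minus (Var v) (Num 1))), s) (Skip, s(v := y))"
  using assms(1,3)
  proof (induction "nat (s v - y0)" arbitrary: s rule: less_induct)
    case less
    let ?w = "While b (Assign v (Minus (Var v) (Num 1)))"
    have bs: "bval b s \<longleftrightarrow> \<not> P (s v)" using less.prems(1)[of "s v"] by simp
    show ?case
    proof (cases "P (s v)")
      case True
      then have "step (?w, s) (Skip, s(v := s v))" using bs by (simp add: step.WhileFalse)
      then show ?thesis using True by (intro exI[of _ "s v"]) auto
    next
      case False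
      define s' where "s' = s(v := s v - 1)"
      have "step (?w, s) (Seq (Assign v (Minus (Var v) (Num 1))) ?w, s)"
        using bs False by (simp add: step.WhileTrue)
      moreover have "step (Seq (Assign v (Minus (Var v) (Num 1))) ?w, s) (Seq Skip ?w, s')"
        unfolding s'_def using step.Seq2[OF step.Assign[of v "Minus (Var v) (Num 1)" s]] by simp
      moreover have "step (Seq Skip ?w, s') (?w, s')" by (rule step.Seq1)
      ultimately have *: "steps (?w, s) (?w, s')" by (meson converse_rtranclp_into_rtranclp r_into_rtranclp)
      have "y0 \<noteq> s v" using False \<open>P y0\<close> by auto
      then have "nat (s' v - y0) < nat (s v - y0)" "y0 \<le> s' v"
        using less.prems(2) by (simp_all add: s'_def)
      moreover have "bval b (s'(v := y)) \<longleftrightarrow> \<not> P y" for y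
        using less.prems(1)[of y] by (simp add: s'_def)
      ultimately obtain y where y: "P y" "y \<le> s' v" "\<forall>z. P z \<and> z \<le> s' v \<longrightarrow> z \<le> y"
        "steps (?w, s') (Skip, s'(v := y))"
        using less.hyps by blast
      have "steps (?w, s) (Skip, s(v := y))"
        using rtranclp_trans[OF * y(4)] by (simp add: s'_def)
      moreover have "z \<le> s' v" if "P z" "z \<le> s v" for z
        using that False by (cases "z = s v") (auto simp: s'_def)
      ultimately show ?thesis using y by (intro exI[of _ y]) (auto simp: s'_def)
    qed
qed

text \<open>A pair \<open>(a, b)\<close> with \<open>0 \<le> b < B\<close> is coded as \<open>a * B + b\<close>, so that searching downwards
  for a code maximizes \<open>a\<close> first.\<close>

definition solution_test :: bexp where
  "solution_test = (let a = Div (Var ''x'') (Var ''B''); b = Mod (Var ''x'') (Var ''B'');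
      l = Minus (Times a a) (Times b b); r = Times (Var ''D'') (Times (Var ''M'') (Var ''M''))
    in Neg (Conj (Neg (Less l r)) (Conj (Neg (Less r l)) (Neg (Less a (Times (Num 2) b))))))"

text \<open>The language compares only by \<open>Less\<close>, so a zero remainder is expressed as a
  remainder below 1; for positive \<open>k\<close> remainders are never negative.\<close>

definition gcd_test :: bexp where
  "gcd_test = Neg (Conj (Less (Mod (Var ''a'') (Var ''k'')) (Num 1))
    (Conj (Less (Mod (Var ''b'') (Var ''k'')) (Num 1)) (Less (Mod (Var ''M'') (Var ''k'')) (Num 1))))"

text \<open>\<open>B\<close> exceeds every possible \<open>a\<close>, hence every \<open>b\<close>,
  so codes of solutions decode correctly and are at most \<open>B * B\<close>, where the first
  search starts. The second starts at \<open>M\<close> because the gcd divides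
  \<open>M\<close>.\<close>

definition prog :: com where
  "prog =
    Seq (Assign ''B'' (Plus (Times (Num 2) (Times (Var ''D'') (Var ''M''))) (Num 1)))
   (Seq (Assign ''x'' (Times (Var ''B'') (Var ''B'')))
   (Seq (While solution_test (Assign ''x'' (Minus (Var ''x'') (Num 1))))
   (Seq (Assign ''a'' (Div (Var ''x'') (Var ''B'')))
   (Seq (Assign ''b'' (Mod (Var ''x'') (Var ''B'')))
   (Seq (Assign ''k'' (Var ''M''))
   (Seq (While gcd_test (Assign ''k'' (Minus (Var ''k'') (Num 1))))
   (Seq (Assign ''q'' (Div (Var ''a'') (Var ''k'')))
   (Seq (Assign ''p'' (Div (Var ''b'') (Var ''k'')))
        (Assign ''r'' (Div (Var ''M'') (Var ''k'')))))))))))"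

section \<open>Correctness of the search\<close>

text \<open>From 4b^2 \<le> a^2 follows a^2 \<le> 4 D M^2. Replacing D by D^2 is wasteful but makes
  the bound a perfect square, so the program needs no square root.\<close>

lemma solution_bound:
  fixes a b M D :: int
  assumes "0 \<le> b" "2 * b \<le> a" "0 < M" "0 < D" and eq: "a\<^sup>2 - b\<^sup>2 = D * M\<^sup>2"
  shows "a \<le> 2 * D * M"
proof -
  have "(2 * b)\<^sup>2 \<le> a\<^sup>2" using assms by (intro power_mono) auto
  then have "4 * b\<^sup>2 \<le> a\<^sup>2" by (simp add: power_mult_distrib)
  then have "a\<^sup>2 \<le> 4 * (D * M\<^sup>2)" using eq zero_le_power2[of a] by linarith
  also have "\<dots> \<le> 4 * (D\<^sup>2 * M\<^sup>2)"
    using assms by (simp add: self_le_power)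
  also have "\<dots> = (2 * D * M)\<^sup>2" by (simp add: power_mult_distrib)
  finally show ?thesis by (rule power2_le_imp_le) (use assms in simp)
qed

lemma prog_correct:
  fixes a0 b0 M D :: int
  assumes "0 \<le> b0" "2 * b0 \<le> a0" "0 < M" "0 < D" "a0\<^sup>2 - b0\<^sup>2 = D * M\<^sup>2"
  obtains a b t where "0 \<le> b" "2 * b \<le> a" "a\<^sup>2 - b\<^sup>2 = D * M\<^sup>2"
    "\<forall>a' b'. 0 \<le> b' \<and> 2 * b' \<le> a' \<and> a'\<^sup>2 - b'\<^sup>2 = D * M\<^sup>2 \<longrightarrow> a' \<le> a"
    "steps (prog, input M D) (Skip, t)"
    "t ''k'' = gcd (gcd a b) M" "t ''p'' = b div gcd (gcd a b) M"
    "t ''q'' = a div gcd (gcd a b) M" "t ''r'' = M div gcd (gcd a b) M"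
proof -
  define B where "B = 2 * D * M + 1"
  define sol where "sol = (\<lambda>a b. 0 \<le> b \<and> 2 * b \<le> a \<and> a\<^sup>2 - b\<^sup>2 = D * M\<^sup>2)"
  have "0 < D * M" using assms by simp
  then have B: "0 < B" unfolding B_def by linarith
  have coded: "sol ((a * B + b) div B) ((a * B + b) mod B) \<and> a * B + b \<le> B * B \<and>
      (a * B + b) div B = a" if "sol a b" for a b
  proof -
    have "a \<le> 2 * D * M"
      using that assms(3,4) unfolding sol_def by (intro solution_bound[of b a M D]) blast+
    then have ab: "0 \<le> b" "b < B" "a + 1 \<le> B" using that unfolding sol_def B_def by linarith+
    have "(a * B + b) div B = a" "(a * B + b) mod B = b"
      using ab B by (simp_all add: div_pos_pos_trivial mod_pos_pos_trivial)
    moreover have "(a + 1) * B \<le> B * B" using ab(3) B by (intro mult_right_mono) linarith+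
    then have "a * B + b \<le> B * B" using ab(2) unfolding distrib_right mult_1 by linarith
    ultimately show ?thesis using that by metis
  qed
  have sol0: "sol a0 b0" using assms by (simp add: sol_def)
  let ?in = "input M D"
  let ?s1 = "?in(''B'' := B)"
  let ?s2 = "?s1(''x'' := B * B)"
  have "bval solution_test (?s2(''x'' := y)) = (\<not> sol (y div B) (y mod B))" for y
  proof -
    define u v where "u = y div B" and "v = y mod B"
    have "bval solution_test (?s2(''x'' := y)) \<longleftrightarrow>
        \<not> (\<not> u * u - v * v < D * (M * M) \<and> \<not> D * (M * M) < u * u - v * v \<and> \<not> u < 2 * v)"
      by (simp only: solution_test_def Let_def bval.simps aval.simps)
        (simp add: input_def u_def v_def)
    moreover have "0 \<le> v" using B by (simp add: v_def)
    ultimately show ?thesis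
      unfolding sol_def power2_eq_square u_def[symmetric] v_def[symmetric] not_less
      by (metis order_antisym order_refl)
  qed
  moreover have "sol ((a0 * B + b0) div B) ((a0 * B + b0) mod B)"
    using coded[OF sol0] by blast
  moreover have "a0 * B + b0 \<le> ?s2 ''x''" using coded[OF sol0] by simp
  ultimately obtain x where x: "sol (x div B) (x mod B)"
    "\<forall>z. sol (z div B) (z mod B) \<and> z \<le> ?s2 ''x'' \<longrightarrow> z \<le> x"
    and st: "steps (While solution_test (Assign ''x'' (Minus (Var ''x'') (Num 1))), ?s2)
      (Skip, ?s2(''x'' := x))"
    using steps_search_down[of solution_test ?s2 "''x''" "\<lambda>x. sol (x div B) (x mod B)"] by blast
  define a b where "a = x div B" and "b = x mod B"
  \<comment> \<open>Codes of solutions lie in the searched range, so none exceeds \<open>x\<close>;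
    division by \<open>B\<close> is monotone and carries this over to the first components.\<close>
  have max: "a' \<le> a" if "sol a' b'" for a' b'
  proof -
    have c: "sol ((a' * B + b') div B) ((a' * B + b') mod B)" "a' * B + b' \<le> B * B"
      "(a' * B + b') div B = a'"
      using coded[OF that] by blast+
    have "a' * B + b' \<le> x"
      by (rule x(2)[rule_format], intro conjI, rule c(1), simp add: c(2))
    from zdiv_mono1[OF this B] show ?thesis unfolding c(3) a_def .
  qed
  define k where "k = gcd (gcd a b) M"
  let ?s5 = "(?s2(''x'' := x))(''a'' := a, ''b'' := b)"
  let ?s6 = "?s5(''k'' := M)"
  let ?P = "\<lambda>k. a mod k < 1 \<and> b mod k < 1 \<and> M mod k < 1"
  have k: "0 < k" "k \<le> M" "k dvd a" "k dvd b" "k dvd M"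
    using assms unfolding k_def
    by (simp, simp add: zdvd_imp_le, (meson gcd_dvd1 gcd_dvd2 dvd_trans)+)
  have "bval gcd_test (?s6(''k'' := y)) = (\<not> ?P y)" for y
    by (simp add: gcd_test_def input_def)
  moreover have "?P k" "k \<le> ?s6 ''k''" using k by simp_all
  ultimately obtain k' where k': "?P k'" "\<forall>z. ?P z \<and> z \<le> ?s6 ''k'' \<longrightarrow> z \<le> k'"
    and st': "steps (While gcd_test (Assign ''k'' (Minus (Var ''k'') (Num 1))), ?s6)
      (Skip, ?s6(''k'' := k'))"
    using steps_search_down[of gcd_test ?s6 "''k''" ?P] by blast
  \<comment> \<open>The true gcd passes the test, so the search stops no lower. This makes
    \<open>k'\<close> positive, its remainders vanish, and as a common divisor it divides
    \<open>k\<close>.\<close>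
  have "k \<le> k'" using k'(2)[rule_format, of k] k by simp
  then have "0 < k'" using k(1) by simp
  then have "a mod k' = 0" "b mod k' = 0" "M mod k' = 0"
    using k'(1) pos_mod_sign[of k' a] pos_mod_sign[of k' b] pos_mod_sign[of k' M] by linarith+
  then have "k' dvd a" "k' dvd b" "k' dvd M" by (simp_all add: dvd_eq_mod_eq_0)
  then have "k' dvd k" by (simp add: k_def)
  then have "k' = k" using \<open>k \<le> k'\<close> k(1) zdvd_imp_le by fastforce
  let ?s7 = "?s6(''k'' := k)"
  let ?s10 = "?s7(''q'' := a div k, ''p'' := b div k, ''r'' := M div k)"
  have h1: "steps (Assign ''B'' (Plus (Times (Num 2) (Times (Var ''D'') (Var ''M''))) (Num 1)), ?in)
    (Skip, ?s1)"
    using steps_Assign[of "''B''" "Plus (Times (Num 2) (Times (Var ''D'') (Var ''M''))) (Num 1)" ?in]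
    by (simp add: input_def B_def mult.assoc)
  have h2: "steps (Assign ''x'' (Times (Var ''B'') (Var ''B'')), ?s1) (Skip, ?s2)"
    using steps_Assign[of "''x''" "Times (Var ''B'') (Var ''B'')" ?s1] by simp
  have h3: "steps (Assign ''a'' (Div (Var ''x'') (Var ''B'')), ?s2(''x'' := x))
    (Skip, ?s2(''x'' := x, ''a'' := a))"
    using steps_Assign[of "''a''" "Div (Var ''x'') (Var ''B'')" "?s2(''x'' := x)"] by (simp add: a_def)
  have h4: "steps (Assign ''b'' (Mod (Var ''x'') (Var ''B'')), ?s2(''x'' := x, ''a'' := a)) (Skip, ?s5)"
    using steps_Assign[of "''b''" "Mod (Var ''x'') (Var ''B'')" "?s2(''x'' := x, ''a'' := a)"]
    by (simp add: b_def)
  have h5: "steps (Assign ''k'' (Var ''M''), ?s5) (Skip, ?s6)"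
    using steps_Assign[of "''k''" "Var ''M''" ?s5] by (simp add: input_def)
  have h6: "steps (Assign ''q'' (Div (Var ''a'') (Var ''k'')), ?s7) (Skip, ?s7(''q'' := a div k))"
    using steps_Assign[of "''q''" "Div (Var ''a'') (Var ''k'')" ?s7] by simp
  have h7: "steps (Assign ''p'' (Div (Var ''b'') (Var ''k'')), ?s7(''q'' := a div k))
    (Skip, ?s7(''q'' := a div k, ''p'' := b div k))"
    using steps_Assign[of "''p''" "Div (Var ''b'') (Var ''k'')" "?s7(''q'' := a div k)"] by simp
  have h8: "steps (Assign ''r'' (Div (Var ''M'') (Var ''k'')), ?s7(''q'' := a div k, ''p'' := b div k))
    (Skip, ?s10)"
    using steps_Assign[of "''r''" "Div (Var ''M'') (Var ''k'')"
        "?s7(''q'' := a div k, ''p'' := b div k)"]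
    by (simp add: input_def)
  have "steps (prog, ?in) (Skip, ?s10)"
    unfolding prog_def
    by (rule steps_Seq[OF h1 steps_Seq[OF h2 steps_Seq[OF st steps_Seq[OF h3 steps_Seq[OF h4
      steps_Seq[OF h5 steps_Seq[OF st'[unfolded \<open>k' = k\<close>] steps_Seq[OF h6 steps_Seq[OF h7 h8]]]]]]]]])
  moreover have "sol a b" using x(1) by (simp add: a_def b_def)
  ultimately show thesis using that[of b a ?s10] max unfolding sol_def k_def by simp
qed

section \<open>Optimal lattices\<close>

text \<open>As \<open>D\<close> is positive, the equation fixes r^2 and thus the positive
  \<open>r\<close>, which resolves the definite description.\<close>

lemma Omega_eq:
  assumes "0 < r" "0 < D" "p\<^sup>2 + D * r\<^sup>2 = q\<^sup>2"
  shows "Omega D p q = lattice_of (vector [vector [real_of_int q, real_of_int p],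
    vector [0, real_of_int r * sqrt (real_of_int D)]])"
proof -
  have "(THE r. 0 < r \<and> p\<^sup>2 + D * r\<^sup>2 = q\<^sup>2) = r"
  proof (rule the_equality)
    fix r' assume "0 < r' \<and> p\<^sup>2 + D * r'\<^sup>2 = q\<^sup>2"
    then have "0 < r'" "D * r'\<^sup>2 = D * r\<^sup>2" using assms(3) by linarith+
    then show "r' = r" using assms by (simp add: power2_eq_iff)
  qed (use assms in simp)
  then show ?thesis by (simp add: Omega_def)
qed

text \<open>Both columns of the matrix of \<open>Omega\<close> have squared length q^2, and their
  inner product is p q. Scaling by sqrt(k/q) turns these into k q and k p, a reduced Gram
  matrix.\<close>

lemma scaled_Omega:
  fixes p q r k D :: int
  assumes "0 < r" "0 < D" "0 < q" "0 < k" "0 \<le> p" "2 * p \<le> q"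
    and eq: "p\<^sup>2 + D * r\<^sup>2 = q\<^sup>2"
  defines "L \<equiv> (\<lambda>x. sqrt (real_of_int k / real_of_int q) *\<^sub>R x) ` Omega D p q"
  shows "IWR L" "lattice_det L = real_of_int (k * r) * sqrt (real_of_int D)"
    "min_norm L = real_of_int (k * q)"
proof -
  define c where "c = sqrt (real_of_int k / real_of_int q)"
  define A0 :: "real^2^2" where "A0 = vector [vector [real_of_int q, real_of_int p],
    vector [0, real_of_int r * sqrt (real_of_int D)]]"
  define A where "A = c *\<^sub>R A0"
  have L: "L = lattice_of A"
    unfolding L_def c_def[symmetric] Omega_eq[OF assms(1,2) eq] A_def A0_def lattice_of_scaleR ..
  have cc: "c * c = real_of_int k / real_of_int q" using assms by (simp add: c_def)
  have req: "real_of_int p * real_of_int p + real_of_int D * (real_of_int r * real_of_int r) =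
      real_of_int q * real_of_int q"
    using arg_cong[OF eq, of real_of_int] by (simp add: power2_eq_square)
  have col0: "column 1 A0 \<bullet> column 1 A0 = real_of_int q * real_of_int q"
    "column 2 A0 \<bullet> column 2 A0 = real_of_int q * real_of_int q"
    "column 1 A0 \<bullet> column 2 A0 = real_of_int q * real_of_int p"
    using req assms(2) by (simp_all add: A0_def column_def inner_vec_def sum_2 mult_ac)
  have col: "column i A = c *\<^sub>R column i A0" for i
    by (simp add: A_def column_def vec_eq_iff)
  have "column 1 A \<bullet> column 1 A = of_int (k * q)" "column 2 A \<bullet> column 2 A = of_int (k * q)"
    "column 1 A \<bullet> column 2 A = of_int (k * p)"
    unfolding col inner_scaleR_left inner_scaleR_right col0 using cc assms
    by (simp_all flip: mult.assoc)
  moreover have "0 < k * q" "2 * \<bar>k * p\<bar> \<le> k * q"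
    using assms by (simp_all add: abs_mult mult.left_commute[of 2])
  ultimately have iwr: "IWR L" "lattice_det L = sqrt (of_int ((k * q)\<^sup>2 - (k * p)\<^sup>2))"
    "min_norm L = of_int (k * q)"
    unfolding L by (rule IWR_of_reduced_basis)+
  then show "IWR L" "min_norm L = of_int (k * q)" by simp_all
  have "(k * q)\<^sup>2 - (k * p)\<^sup>2 = (k * r)\<^sup>2 * D"
    by (simp add: power_mult_distrib eq[symmetric] algebra_simps)
  then have "lattice_det L = sqrt ((real_of_int (k * r))\<^sup>2 * real_of_int D)"
    using iwr(2) by simp
  then show "lattice_det L = real_of_int (k * r) * sqrt (real_of_int D)"
    using assms by (simp add: real_sqrt_mult)
qed

text \<open>This is the converse of \<open>solution_param\<close>: scaling the triple of a pair by k
  = M/r gives a solution for \<open>M\<close>.\<close>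

lemma mn_setE:
  assumes "(m, n) \<in> mn_set D M" "0 < D" "0 < M"
  obtains k where "0 < k" "M = k * r_of D m n" "0 < r_of D m n" "0 < q_of D m n" "0 \<le> p_of D m n"
    "2 * p_of D m n \<le> q_of D m n" "(k * q_of D m n)\<^sup>2 - (k * p_of D m n)\<^sup>2 = D * M\<^sup>2"
proof -
  have mn: "0 < m" "0 < n" "2 * p_of D m n \<le> q_of D m n" "r_of D m n dvd M"
    using assms by (simp_all add: mn_set_iff)
  note signs = pqr_signs[OF mn(1,2) assms(2)]
  obtain k where M: "M = k * r_of D m n" using mn(4) by (metis dvdE mult.commute)
  have "0 < k" using M assms(3) signs(2) by (simp add: zero_less_mult_iff)
  moreover have "(k * q_of D m n)\<^sup>2 - (k * p_of D m n)\<^sup>2 = D * M\<^sup>2"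
    unfolding M power_mult_distrib pqr_equation[OF assms(2), of m n, symmetric]
    by (simp add: algebra_simps)
  ultimately show thesis using that M signs mn by blast
qed

lemma mn_maximizer_iff:
  assumes "0 < D"
  shows "mn_maximizer D M m n \<longleftrightarrow> (m, n) \<in> mn_set D M \<and>
    (\<forall>m' n'. (m', n') \<in> mn_set D M \<longrightarrow>
      real_of_int (q_of D m' n') / real_of_int (r_of D m' n') \<le>
      real_of_int (q_of D m n) / real_of_int (r_of D m n))"
proof -
  define R where "R = (\<lambda>m n. real_of_int (q_of D m n) / real_of_int (r_of D m n))"
  have "real_of_int m / real_of_int n + real_of_int D * (real_of_int n / real_of_int m) = 2 * R m n"
    if "(m, n) \<in> mn_set D M" for m n
    unfolding R_def using that assms by (intro objective_eq) (simp_all add: mn_set_iff)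
  then have "mn_maximizer D M m n \<longleftrightarrow> (m, n) \<in> mn_set D M \<and>
      (\<forall>m' n'. (m', n') \<in> mn_set D M \<longrightarrow> R m' n' \<le> R m n)"
    unfolding mn_maximizer_def is_arg_max_def by (auto simp: not_less)
  then show ?thesis by (simp only: R_def)
qed

lemma lattice_det_min_norm_param:
  fixes L :: "(real^2) set"
  assumes "IWR L" "lattice_det L = real_of_int M * sqrt (real_of_int D)"
    "0 < M" "0 < D" "squarefree D"
  obtains m n where "(m, n) \<in> mn_set D M"
    "min_norm L = real_of_int M * (real_of_int (q_of D m n) / real_of_int (r_of D m n))"
proof -
  obtain a b :: int where ab: "0 \<le> b" "2 * b \<le> a" "(lattice_det L)\<^sup>2 = of_int (a\<^sup>2 - b\<^sup>2)"
    "min_norm L = of_int a"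
    using IWR_obtains_solution[OF assms(1)] by metis
  have "real_of_int (a\<^sup>2 - b\<^sup>2) = real_of_int (D * M\<^sup>2)"
    unfolding ab(3)[symmetric] assms(2) using assms(4) by (simp add: power_mult_distrib)
  then have eq: "a\<^sup>2 - b\<^sup>2 = D * M\<^sup>2" by (simp only: of_int_eq_iff)
  obtain k m n where mn: "(m, n) \<in> mn_set D M" "a = k * q_of D m n" "M = k * r_of D m n"
    using solution_param[OF ab(1,2) assms(3-5) eq] by metis
  have "r_of D m n \<noteq> 0" using mn(3) assms(3) by auto
  then have "min_norm L = real_of_int M * (real_of_int (q_of D m n) / real_of_int (r_of D m n))"
    unfolding ab(4) by (subst mn(2), subst mn(3)) simp
  then show thesis using that mn(1) by blast
qed

lemma IWR_det_iff:
  assumes "0 < \<Delta>"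
  shows "(\<exists>L::(real^2) set. IWR L \<and> lattice_det L = \<Delta>) \<longleftrightarrow>
    (\<exists>M D. 0 < M \<and> 0 < D \<and> squarefree D \<and>
      \<Delta> = real_of_int M * sqrt (real_of_int D) \<and> mn_set D M \<noteq> {})"
proof
  assume "\<exists>L::(real^2) set. IWR L \<and> lattice_det L = \<Delta>"
  then obtain L :: "(real^2) set" where L: "IWR L" "lattice_det L = \<Delta>" by blast
  obtain a b :: int where ab: "\<Delta>\<^sup>2 = of_int (a\<^sup>2 - b\<^sup>2)"
    using IWR_obtains_solution[OF L(1)] L(2) by metis
  define N where "N = a\<^sup>2 - b\<^sup>2"
  \<comment> \<open>The integer D M^2 determines the squarefree \<open>D\<close>; the absolute value
    makes \<open>M\<close> positive.\<close>
  define D where "D = squarefree_part N"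
  define M where "M = \<bar>square_part N\<bar>"
  have "0 < \<Delta>\<^sup>2" using assms by simp
  then have "0 < N" unfolding ab N_def by (simp only: of_int_0_less_iff)
  have N: "N = D * M\<^sup>2" unfolding D_def M_def power2_abs by (rule squarefree_decompose)
  have "0 < D * M\<^sup>2" using \<open>0 < N\<close> N by simp
  then have "0 < D" "M \<noteq> 0" by (auto simp: zero_less_mult_iff)
  then have "0 < M" by (simp add: M_def)
  have "\<Delta> = sqrt (\<Delta>\<^sup>2)" using assms by simp
  also have "\<dots> = real_of_int M * sqrt (real_of_int D)"
    unfolding ab N_def[symmetric] N using \<open>0 < M\<close> by (simp add: real_sqrt_mult)
  finally have \<Delta>: "\<Delta> = real_of_int M * sqrt (real_of_int D)" .
  have "squarefree D" by (simp add: D_def)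
  moreover from this obtain m n where "(m, n) \<in> mn_set D M"
    using lattice_det_min_norm_param L \<Delta> \<open>0 < M\<close> \<open>0 < D\<close> by metis
  ultimately show "\<exists>M D. 0 < M \<and> 0 < D \<and> squarefree D \<and>
      \<Delta> = real_of_int M * sqrt (real_of_int D) \<and> mn_set D M \<noteq> {}"
    using \<Delta> \<open>0 < M\<close> \<open>0 < D\<close> by blast
next
  assume "\<exists>M D. 0 < M \<and> 0 < D \<and> squarefree D \<and>
    \<Delta> = real_of_int M * sqrt (real_of_int D) \<and> mn_set D M \<noteq> {}"
  then obtain M D m n where *: "0 < M" "0 < D" "\<Delta> = real_of_int M * sqrt (real_of_int D)"
    "(m, n) \<in> mn_set D M" by auto
  show "\<exists>L::(real^2) set. IWR L \<and> lattice_det L = \<Delta>"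
    using *(4,2,1)
  proof (rule mn_setE)
    fix k assume k: "0 < k" "M = k * r_of D m n" "0 < r_of D m n" "0 < q_of D m n"
      "0 \<le> p_of D m n" "2 * p_of D m n \<le> q_of D m n"
    show ?thesis
      using scaled_Omega(1,2)[OF k(3) *(2) k(4,1,5,6) pqr_equation[OF *(2)]] *(3) k(2) by metis
  qed
qed

text \<open>Any competitor has minimal norm M q'/r' for some pair in \<open>mn_set\<close>, so
  maximality of q/r bounds it.\<close>

lemma maximizer_lattice:
  fixes L' :: "(real^2) set"
  assumes "0 < M" "0 < D" "squarefree D" and max: "mn_maximizer D M m n"
  defines "k \<equiv> real_of_int M / real_of_int (r_of D m n)"
  defines "L \<equiv> (\<lambda>x. sqrt (k / real_of_int (q_of D m n)) *\<^sub>R x) ` Omega D (p_of D m n) (q_of D m n)"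
  shows "IWR L" "lattice_det L = real_of_int M * sqrt (real_of_int D)"
    "min_norm L = k * real_of_int (q_of D m n)"
    "IWR L' \<Longrightarrow> lattice_det L' = real_of_int M * sqrt (real_of_int D) \<Longrightarrow> min_norm L' \<le> min_norm L"
proof -
  have mn: "(m, n) \<in> mn_set D M" using max by (simp add: mn_maximizer_iff[OF assms(2)])
  obtain k' where k': "0 < k'" "M = k' * r_of D m n" "0 < r_of D m n" "0 < q_of D m n"
      "0 \<le> p_of D m n" "2 * p_of D m n \<le> q_of D m n"
    using mn_setE[OF mn assms(2,1)] by blast
  \<comment> \<open>The real quotient M/r is an integer, which is the form that
    \<open>scaled_Omega\<close> takes.\<close>
  have k: "k = real_of_int k'" using k'(3) by (subst k_def, subst k'(2)) simp
  note * = scaled_Omega[OF k'(3) assms(2) k'(4,1,5,6) pqr_equation[OF assms(2)],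
      folded k k'(2), folded L_def]
  show "IWR L" "lattice_det L = real_of_int M * sqrt (real_of_int D)" by (fact *)+
  show minL: "min_norm L = k * real_of_int (q_of D m n)" using *(3) by (simp add: k)
  assume "IWR L'" "lattice_det L' = real_of_int M * sqrt (real_of_int D)"
  then obtain m' n' where "(m', n') \<in> mn_set D M"
    "min_norm L' = real_of_int M * (real_of_int (q_of D m' n') / real_of_int (r_of D m' n'))"
    using lattice_det_min_norm_param assms(1-3) by metis
  moreover from this have "real_of_int (q_of D m' n') / real_of_int (r_of D m' n') \<le>
      real_of_int (q_of D m n) / real_of_int (r_of D m n)"
    using max by (simp add: mn_maximizer_iff[OF assms(2)])
  ultimately show "min_norm L' \<le> min_norm L"
    unfolding minL k_def using assms(1) mult_left_mono[of _ _ "real_of_int M"] by fastforce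
qed

text \<open>The program never computes \<open>m\<close> and \<open>n\<close>; it maximizes
  \<open>a\<close> over all solutions. The solution found comes from some pair, and every other pair
  gives a solution with a' = M q'/r' at most \<open>a\<close>, so the pair is a maximizer.\<close>

lemma prog_finds_maximizer:
  assumes "0 < M" "0 < D" "squarefree D" "mn_set D M \<noteq> {}"
  obtains j t m n where "halts_after prog (input M D) j t" "mn_maximizer D M m n"
    "t ''p'' = p_of D m n" "t ''r'' = r_of D m n" "t ''q'' = q_of D m n"
    "real_of_int (t ''k'') = real_of_int M / real_of_int (r_of D m n)"
proof -
  have sol: "\<exists>k a b. 0 < k \<and> a = k * q_of D m n \<and> M = k * r_of D m n \<and>
      0 \<le> b \<and> 2 * b \<le> a \<and> a\<^sup>2 - b\<^sup>2 = D * M\<^sup>2"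
    if mn: "(m, n) \<in> mn_set D M" for m n
    using mn assms(2,1)
  proof (rule mn_setE)
    fix k assume k: "0 < k" "M = k * r_of D m n" "0 \<le> p_of D m n" "2 * p_of D m n \<le> q_of D m n"
      "(k * q_of D m n)\<^sup>2 - (k * p_of D m n)\<^sup>2 = D * M\<^sup>2"
    have "0 \<le> k * p_of D m n" using k(1,3) by simp
    moreover have "2 * (k * p_of D m n) \<le> k * q_of D m n"
      using mult_left_mono[OF k(4), of k] k(1) by (simp add: mult.left_commute)
    ultimately show ?thesis using k(1,2,5) by blast
  qed
  obtain a0 b0 where ab0: "0 \<le> b0" "2 * b0 \<le> a0" "a0\<^sup>2 - b0\<^sup>2 = D * M\<^sup>2"
  proof -
    obtain m n where "(m, n) \<in> mn_set D M" using assms(4) by auto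
    from sol[OF this] show thesis using that by blast
  qed
  obtain a b t where ab: "0 \<le> b" "2 * b \<le> a" "a\<^sup>2 - b\<^sup>2 = D * M\<^sup>2"
    and max: "\<forall>a' b'. 0 \<le> b' \<and> 2 * b' \<le> a' \<and> a'\<^sup>2 - b'\<^sup>2 = D * M\<^sup>2 \<longrightarrow> a' \<le> a"
    and run: "steps (prog, input M D) (Skip, t)"
    and t: "t ''k'' = gcd (gcd a b) M" "t ''p'' = b div gcd (gcd a b) M"
      "t ''q'' = a div gcd (gcd a b) M" "t ''r'' = M div gcd (gcd a b) M"
    by (rule prog_correct[OF ab0(1,2) assms(1,2) ab0(3)])
  define k where "k = gcd (gcd a b) M"
  have "0 < k" using assms(1) by (simp add: k_def)
  obtain m n where mn: "(m, n) \<in> mn_set D M" "a = k * q_of D m n" "b = k * p_of D m n"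
    "M = k * r_of D m n"
    unfolding k_def using solution_param[OF ab(1,2) assms(1-3) ab(3)] by blast
  have pqr: "t ''k'' = k" "t ''p'' = p_of D m n" "t ''q'' = q_of D m n" "t ''r'' = r_of D m n"
    unfolding t k_def[symmetric] using mn(2-4) \<open>0 < k\<close> by (metis nonzero_mult_div_cancel_left order_less_irrefl)+
  have "mn_maximizer D M m n"
    unfolding mn_maximizer_iff[OF assms(2)]
  proof (intro conjI allI impI)
    fix m' n' assume "(m', n') \<in> mn_set D M"
    from sol[OF this] obtain k' a' b'
      where *: "0 < k'" "a' = k' * q_of D m' n'" "M = k' * r_of D m' n'"
        "0 \<le> b'" "2 * b' \<le> a'" "a'\<^sup>2 - b'\<^sup>2 = D * M\<^sup>2"
      by blast
    have ratio: "real_of_int x / real_of_int y = real_of_int (l * x) / real_of_int (l * y)"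
      if "0 < l" for x y l :: int
      using that by simp
    have "real_of_int (q_of D m' n') / real_of_int (r_of D m' n') = real_of_int a' / real_of_int M"
      using ratio[OF *(1), of "q_of D m' n'" "r_of D m' n'"] unfolding *(2,3)[symmetric] .
    moreover have "real_of_int (q_of D m n) / real_of_int (r_of D m n) = real_of_int a / real_of_int M"
      using ratio[OF \<open>0 < k\<close>, of "q_of D m n" "r_of D m n"] unfolding mn(2,4)[symmetric] .
    moreover have "a' \<le> a" using max *(4-6) by blast
    ultimately show "real_of_int (q_of D m' n') / real_of_int (r_of D m' n') \<le>
        real_of_int (q_of D m n) / real_of_int (r_of D m n)"
      using assms(1) by (simp add: divide_right_mono)
  qed (fact mn(1))
  moreover obtain j where "halts_after prog (input M D) j t"
    using rtranclp_imp_relpowp[OF run] by (auto simp: halts_after_def)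
  moreover have "real_of_int k = real_of_int M / real_of_int (r_of D m n)"
  proof -
    have "r_of D m n \<noteq> 0" using mn(4) assms(1) by auto
    then show ?thesis using arg_cong[OF mn(4), of real_of_int] by simp
  qed
  ultimately show thesis using that pqr by metis
qed

theorem theorem1p3:
  shows "(\<forall>\<Delta>::real. 0 < \<Delta> \<longrightarrow>
      ((\<exists>\<Lambda>::(real^2) set. IWR \<Lambda> \<and> lattice_det \<Lambda> = \<Delta>) \<longleftrightarrow>
       (\<exists>M D. 0 < M \<and> 0 < D \<and> squarefree D \<and>
              \<Delta> = real_of_int M * sqrt (real_of_int D) \<and> mn_set D M \<noteq> {})))
    \<and> (\<forall>(\<Delta>::real) M D m n.
      0 < M \<and> 0 < D \<and> squarefree D \<and> \<Delta> = real_of_int M * sqrt (real_of_int D) \<and>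
      mn_maximizer D M m n \<longrightarrow>
      (let p = p_of D m n; r = r_of D m n; q = q_of D m n;
           k = real_of_int M / real_of_int r;
           \<Lambda> = (\<lambda>x. sqrt (k / real_of_int q) *\<^sub>R x) ` Omega D p q
       in IWR \<Lambda> \<and> lattice_det \<Lambda> = \<Delta> \<and> min_norm \<Lambda> = k * real_of_int q \<and>
          (\<forall>\<Lambda>'::(real^2) set. IWR \<Lambda>' \<and> lattice_det \<Lambda>' = \<Delta> \<longrightarrow> min_norm \<Lambda>' \<le> min_norm \<Lambda>)))
    \<and> (\<exists>c. \<forall>M D. 0 < M \<and> 0 < D \<and> squarefree D \<and> mn_set D M \<noteq> {} \<longrightarrow>
      (\<exists>j t m n. halts_after c (input M D) j t \<and> mn_maximizer D M m n \<and>
         t ''p'' = p_of D m n \<and> t ''r'' = r_of D m n \<and> t ''q'' = q_of D m n \<and>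
         real_of_int (t ''k'') = real_of_int M / real_of_int (r_of D m n)))"
proof (intro conjI)
  show "\<forall>\<Delta>::real. 0 < \<Delta> \<longrightarrow>
      ((\<exists>\<Lambda>::(real^2) set. IWR \<Lambda> \<and> lattice_det \<Lambda> = \<Delta>) \<longleftrightarrow>
       (\<exists>M D. 0 < M \<and> 0 < D \<and> squarefree D \<and>
              \<Delta> = real_of_int M * sqrt (real_of_int D) \<and> mn_set D M \<noteq> {}))"
    using IWR_det_iff by blast
next
  show "\<forall>(\<Delta>::real) M D m n.
      0 < M \<and> 0 < D \<and> squarefree D \<and> \<Delta> = real_of_int M * sqrt (real_of_int D) \<and>
      mn_maximizer D M m n \<longrightarrow>
      (let p = p_of D m n; r = r_of D m n; q = q_of D m n;
           k = real_of_int M / real_of_int r;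
           \<Lambda> = (\<lambda>x. sqrt (k / real_of_int q) *\<^sub>R x) ` Omega D p q
       in IWR \<Lambda> \<and> lattice_det \<Lambda> = \<Delta> \<and> min_norm \<Lambda> = k * real_of_int q \<and>
          (\<forall>\<Lambda>'::(real^2) set. IWR \<Lambda>' \<and> lattice_det \<Lambda>' = \<Delta> \<longrightarrow> min_norm \<Lambda>' \<le> min_norm \<Lambda>))"
    unfolding Let_def using maximizer_lattice by blast
next
  show "\<exists>c. \<forall>M D. 0 < M \<and> 0 < D \<and> squarefree D \<and> mn_set D M \<noteq> {} \<longrightarrow>
      (\<exists>j t m n. halts_after c (input M D) j t \<and> mn_maximizer D M m n \<and>
         t ''p'' = p_of D m n \<and> t ''r'' = r_of D m n \<and> t ''q'' = q_of D m n \<and>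
         real_of_int (t ''k'') = real_of_int M / real_of_int (r_of D m n))"
    by (rule exI[of _ prog]) (metis prog_finds_maximizer)
qed

end
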